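(* Let $X=\{x\in\mathbb{R}^n : Ax=b,\ x\geq 0\}$ with $A\in\mathbb{Q}^{m\times n}$, $b\in\mathbb{Q}^m$, and let $c_1,c_2,d_1\in\mathbb{Q}^n$ be (row) objective vectors. Let $x^*\in X$. The following are equivalent: (a) there exist non-negative normalized weights $w^*=(w_1^*,w_2^*,w_3^* )$, i.e. $w^*_i\ge 0$ and $w_1^*+w_2^*+w_3^*=1$, with $w_3^*\neq 1$, such that $x^*$ is optimal for $\mathrm{WS}(\mathrm{TOLP},w^* )$; (b) there exist a parameter value $\lambda\geq 0$ and non-negative normalized weights $w=(w_1,w_2)$, i.e. $w_i\ge 0$ and $w_1+w_2=1$, such that $x^*$ is optimal for $\mathrm{WS}(\mathrm{PBLP}^2(\lambda),w)$.
   Context: $\mathrm{PBLP}^2$ is the parametric biobjective linear program $\min_{x\in X}\,(c_1x+\lambda d_1x,\ c_2x+\lambda d_1x)^\top$ with parameter $\lambda\ge 0$; for fixed $\lambda$ it is denoted $\mathrm{PBLP}^2(\lambda)$. The associated triobjective linear program TOLP is $\min_{x\in X}(c_1x,c_2x,d_1x)^\top$. $\mathrm{WS}(\mathrm{PBLP}^2(\lambda),w)$ is the linear program $\min_{x\in X}\ w_1(c_1x+\lambda d_1x)+w_2(c_2x+\lambda d_1x)$, and $\mathrm{WS}(\mathrm{TOLP},w^* )$ is the linear program $\min_{x\in X}\ w_1^*c_1x+w_2^*c_2x+w_3^*d_1x$. *)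

theory Defs
  imports "HOL-Analysis.Analysis"
begin

definition feasible_set :: "real ^ 'n ^ 'm \<Rightarrow> real ^ 'm \<Rightarrow> (real ^ 'n) set" where
  "feasible_set A b = {x. A *v x = b \<and> (\<forall>j. 0 \<le> x $ j)}"

definition tolp_objective ::
    "real ^ 'n \<Rightarrow> real ^ 'n \<Rightarrow> real ^ 'n \<Rightarrow> real ^ 'n \<Rightarrow> real ^ 3" where
  "tolp_objective c1 c2 d1 x = vector [c1 \<bullet> x, c2 \<bullet> x, d1 \<bullet> x]"

definition pblp2_objective ::
    "real ^ 'n \<Rightarrow> real ^ 'n \<Rightarrow> real ^ 'n \<Rightarrow> real \<Rightarrow> real ^ 'n \<Rightarrow> real ^ 2" where
  "pblp2_objective c1 c2 d1 l x = vector [c1 \<bullet> x + l * (d1 \<bullet> x), c2 \<bullet> x + l * (d1 \<bullet> x)]"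

definition normalized_weights :: "real ^ 'k \<Rightarrow> bool" where
  "normalized_weights w \<longleftrightarrow> (\<forall>i. 0 \<le> w $ i) \<and> (\<Sum>i\<in>UNIV. w $ i) = 1"

definition weighted_sum :: "('x \<Rightarrow> real ^ 'k) \<Rightarrow> real ^ 'k \<Rightarrow> 'x \<Rightarrow> real" where
  "weighted_sum f w x = (\<Sum>i\<in>UNIV. w $ i * f x $ i)"

text \<open>Optimality for the weighted sum problem of minimising \<open>f\<close> over \<open>X\<close>;
  \<^const>\<open>is_arg_min\<close> includes feasibility of \<open>x\<close>.\<close>

definition ws_optimal :: "'x set \<Rightarrow> ('x \<Rightarrow> real ^ 'k) \<Rightarrow> real ^ 'k \<Rightarrow> 'x \<Rightarrow> bool" where
  "ws_optimal X f w x \<longleftrightarrow> is_arg_min (weighted_sum f w) (\<lambda>y. y \<in> X) x"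

end

theory Submission
  imports Defs
begin

text \<open>Since \<open>v\<^sub>1 + v\<^sub>2 = 1\<close>, the weighted sum of PBLP\<open>\<^sup>2\<close>(\<open>l\<close>) with weights \<open>v\<close> is
  \<open>v\<^sub>1 c\<^sub>1 x + v\<^sub>2 c\<^sub>2 x + l d\<^sub>1 x\<close>. Hence normalising \<open>(v\<^sub>1, v\<^sub>2, l)\<close> by \<open>1 + l\<close>, and conversely
  dividing \<open>w\<close> by \<open>w\<^sub>1 + w\<^sub>2 = 1 - w\<^sub>3 > 0\<close>, changes the objective only by a positive factor.\<close>

text \<open>A positive factor cancels from every comparison of objective values. \<open>f\<close>
  and \<open>g\<close> may have different numbers of components, so three objectives can be compared
  with two.\<close>

lemma ws_optimal_scale:
  assumes "k > 0" and "\<And>y. weighted_sum f w y = k * weighted_sum g v y"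
  shows "ws_optimal X f w x \<longleftrightarrow> ws_optimal X g v x"
  using assms by (simp add: ws_optimal_def is_arg_min_def)

text \<open>The factor \<open>k\<close> is left free so that one identity serves both directions:
  the sum of the first two weights in one, \<open>1 / (1 + l)\<close> in the other.\<close>

lemma weighted_sum_tolp_eq_pblp2:
  fixes w :: "real ^ 3" and v :: "real ^ 2"
  assumes "normalized_weights v"
    and "w $ 1 = k * v $ 1" and "w $ 2 = k * v $ 2" and "w $ 3 = k * l"
  shows "weighted_sum (tolp_objective c1 c2 d1) w x
    = k * weighted_sum (pblp2_objective c1 c2 d1 l) v x"
proof -
  have "v $ 1 + v $ 2 = 1"
    using assms(1) by (simp add: normalized_weights_def sum_2)
  moreover have "weighted_sum (pblp2_objective c1 c2 d1 l) v x
      = v $ 1 * (c1 \<bullet> x) + v $ 2 * (c2 \<bullet> x) + (v $ 1 + v $ 2) * (l * (d1 \<bullet> x))"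
    by (simp add: weighted_sum_def pblp2_objective_def sum_2 algebra_simps)
  moreover have "weighted_sum (tolp_objective c1 c2 d1) w x
      = k * (v $ 1 * (c1 \<bullet> x) + v $ 2 * (c2 \<bullet> x) + l * (d1 \<bullet> x))"
    by (simp add: weighted_sum_def tolp_objective_def sum_3 assms(2-) algebra_simps)
  ultimately show ?thesis
    by simp
qed

theorem theorem17:
  fixes A :: "real ^ 'n ^ 'm" and b :: "real ^ 'm"
    and c1 c2 d1 :: "real ^ 'n" and x_star :: "real ^ 'n"
  assumes "\<And>i j. A $ i $ j \<in> \<rat>" and "\<And>i. b $ i \<in> \<rat>"
    and "\<And>j. c1 $ j \<in> \<rat>" and "\<And>j. c2 $ j \<in> \<rat>" and "\<And>j. d1 $ j \<in> \<rat>"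
    and "x_star \<in> feasible_set A b"
  shows "(\<exists>w :: real ^ 3. normalized_weights w \<and> w $ 3 \<noteq> 1 \<and>
            ws_optimal (feasible_set A b) (tolp_objective c1 c2 d1) w x_star)
     \<longleftrightarrow> (\<exists>l\<ge>0. \<exists>w :: real ^ 2. normalized_weights w \<and>
            ws_optimal (feasible_set A b) (pblp2_objective c1 c2 d1 l) w x_star)"
proof
  assume "\<exists>w :: real ^ 3. normalized_weights w \<and> w $ 3 \<noteq> 1 \<and>
            ws_optimal (feasible_set A b) (tolp_objective c1 c2 d1) w x_star"
  then obtain w :: "real ^ 3" where w: "normalized_weights w" "w $ 3 \<noteq> 1"
    and opt: "ws_optimal (feasible_set A b) (tolp_objective c1 c2 d1) w x_star"
    by blast
  define s where "s = w $ 1 + w $ 2"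
  define v :: "real ^ 2" where "v = vector [w $ 1 / s, w $ 2 / s]"
  have nonneg: "0 \<le> w $ i" for i
    using w(1) by (simp add: normalized_weights_def)
  \<comment> \<open>Normalization gives \<open>s = 1 - w $ 3\<close>, so this is where
    \<open>w $ 3 \<noteq> 1\<close> enters.\<close>
  have "s \<noteq> 0"
    using w by (auto simp: s_def normalized_weights_def sum_3)
  with nonneg[of 1] nonneg[of 2] have "s > 0"
    by (simp add: s_def)
  have v: "normalized_weights v"
    using \<open>s > 0\<close> nonneg
    by (simp add: normalized_weights_def v_def forall_2 sum_2 s_def flip: add_divide_distrib)
  \<comment> \<open>The parameter is forced by matching the coefficient of \<open>d1\<close>:
    \<open>w $ 3 = s * l\<close>.\<close>
  have "ws_optimal (feasible_set A b) (pblp2_objective c1 c2 d1 (w $ 3 / s)) v x_star"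
  proof (rule ws_optimal_scale[OF \<open>s > 0\<close>, THEN iffD1, OF _ opt])
    show "weighted_sum (tolp_objective c1 c2 d1) w y
        = s * weighted_sum (pblp2_objective c1 c2 d1 (w $ 3 / s)) v y" for y
      using \<open>s > 0\<close> by (intro weighted_sum_tolp_eq_pblp2[OF v]) (simp_all add: v_def)
  qed
  moreover have "0 \<le> w $ 3 / s"
    using \<open>s > 0\<close> nonneg by simp
  ultimately show "\<exists>l\<ge>0. \<exists>w :: real ^ 2. normalized_weights w \<and>
            ws_optimal (feasible_set A b) (pblp2_objective c1 c2 d1 l) w x_star"
    using v by blast
next
  assume "\<exists>l\<ge>0. \<exists>w :: real ^ 2. normalized_weights w \<and>
            ws_optimal (feasible_set A b) (pblp2_objective c1 c2 d1 l) w x_star"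
  then obtain l and v :: "real ^ 2" where "l \<ge> 0" and v: "normalized_weights v"
    and opt: "ws_optimal (feasible_set A b) (pblp2_objective c1 c2 d1 l) v x_star"
    by blast
  define k where "k = 1 / (1 + l)"
  define w :: "real ^ 3" where "w = vector [k * v $ 1, k * v $ 2, k * l]"
  have "k > 0" and k: "k * (1 + l) = 1"
    using \<open>l \<ge> 0\<close> by (simp_all add: k_def)
  have v_sum: "v $ 1 + v $ 2 = 1" and nonneg: "\<And>i. 0 \<le> v $ i"
    using v by (simp_all add: normalized_weights_def sum_2)
  \<comment> \<open>With \<open>k\<close> factored out, \<open>v_sum\<close> turns the bracket into
    \<open>1 + l\<close>, and \<open>k\<close> then gives total weight 1.\<close>
  have "k * v $ 1 + k * v $ 2 + k * l = k * (v $ 1 + v $ 2 + l)"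
    by (simp add: algebra_simps)
  then have "normalized_weights w"
    using \<open>k > 0\<close> \<open>l \<ge> 0\<close> nonneg v_sum k
    by (simp add: normalized_weights_def w_def forall_3 sum_3)
  \<comment> \<open>The third weight is \<open>k * l = 1 - k\<close>, which is below 1 because
    \<open>k > 0\<close>.\<close>
  moreover have "w $ 3 \<noteq> 1"
    using \<open>k > 0\<close> k by (simp add: w_def distrib_left)
  moreover have "ws_optimal (feasible_set A b) (tolp_objective c1 c2 d1) w x_star"
  proof (rule ws_optimal_scale[OF \<open>k > 0\<close>, THEN iffD2, OF _ opt])
    show "weighted_sum (tolp_objective c1 c2 d1) w y
        = k * weighted_sum (pblp2_objective c1 c2 d1 l) v y" for y
      by (intro weighted_sum_tolp_eq_pblp2[OF v]) (simp_all add: w_def)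
  qed
  ultimately show "\<exists>w :: real ^ 3. normalized_weights w \<and> w $ 3 \<noteq> 1 \<and>
            ws_optimal (feasible_set A b) (tolp_objective c1 c2 d1) w x_star"
    by blast
qed

end
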